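(* If $g(z),h(z)\in\mathbb{F}_2[z]$ satisfy $\gcd(g(z),h(z))=1$, then $$G(z)=\begin{pmatrix}1&1&1&1\\0&g(z)+h(z)&g(z)&h(z)\end{pmatrix}$$ is a generator matrix of a binary self-dual $(4,2)$ convolutional code. Conversely, every binary self-dual $(4,2)$ convolutional code has a generator matrix of this form, for some $g(z),h(z)\in\mathbb{F}_2[z]$ with $\gcd(g(z),h(z))=1$.
   Context: A binary $(n,k)$ convolutional code is an $\mathbb{F}_2[z]$-submodule $\mathcal{C}\subset\mathbb{F}_2[z]^n$ of rank $k$. A generator matrix of $\mathcal{C}$ is a matrix $G(z)\in\mathbb{F}_2[z]^{k\times n}$ whose rows form a basis of $\mathcal{C}$. The dual is $\mathcal{C}^\perp=\{f(z)\in\mathbb{F}_2[z]^n : f(z)c(z)^\top=0\ \forall c(z)\in\mathcal{C}\}$, and $\mathcal{C}$ is self-dual if $\mathcal{C}=\mathcal{C}^\perp$. *)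

theory Defs
  imports
    "HOL-Analysis.Analysis"
    "HOL-Library.Z2"
    "HOL-Computational_Algebra.Polynomial_Factorial"
    "HOL-Computational_Algebra.Field_as_Ring"
begin

text \<open>
  The type \<^typ>\<open>bit\<close> is the field with two elements. As Field_as_Ring does
  for the real numbers, it is made an instance of \<^class>\<open>field_gcd\<close>, so that
  the library's \<^const>\<open>gcd\<close> (normalized to be monic) is available on \<^typ>\<open>bit poly\<close>.
\<close>

instantiation bit ::
  "{unique_euclidean_ring, normalization_euclidean_semiring, normalization_semidom_multiplicative}"
begin

definition [simp]: "normalize_bit = (normalize_field :: bit \<Rightarrow> _)"
definition [simp]: "unit_factor_bit = (unit_factor_field :: bit \<Rightarrow> _)"
definition [simp]: "euclidean_size_bit = (euclidean_size_field :: bit \<Rightarrow> _)"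
definition [simp]: "division_segment (x :: bit) = 1"

instance
  by standard (simp_all add: dvd_field_iff field_split_simps split: if_splits)

end

instantiation bit :: euclidean_ring_gcd
begin

definition gcd_bit :: "bit \<Rightarrow> bit \<Rightarrow> bit" where
  "gcd_bit = Euclidean_Algorithm.gcd"
definition lcm_bit :: "bit \<Rightarrow> bit \<Rightarrow> bit" where
  "lcm_bit = Euclidean_Algorithm.lcm"
definition Gcd_bit :: "bit set \<Rightarrow> bit" where
  "Gcd_bit = Euclidean_Algorithm.Gcd"
definition Lcm_bit :: "bit set \<Rightarrow> bit" where
  "Lcm_bit = Euclidean_Algorithm.Lcm"

instance by standard (simp_all add: gcd_bit_def lcm_bit_def Gcd_bit_def Lcm_bit_def)

end

instance bit :: field_gcd ..

text \<open>
  Module structure of \<open>R\<^sup>n\<close> over a commutative ring \<open>R\<close>: this provides \<open>rvec.subspace\<close>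
  (submodule), \<open>rvec.span\<close> and \<open>rvec.independent\<close>. (The interpretation \<open>vec\<close> of HOL-Analysis
  covers fields only.)
\<close>

interpretation rvec: module "(*s) :: 'a::comm_ring_1 \<Rightarrow> 'a^'n \<Rightarrow> 'a^'n"
  by standard (simp_all add: vec_eq_iff algebra_simps)

text \<open>
  The rank of a submodule of \<open>R\<^sup>n\<close>, for a domain \<open>R\<close>: the largest size of a linearly
  independent subset. Such sizes are bounded by \<open>n\<close>, so the maximum exists.
\<close>

definition module_rank :: "('a::idom^'n) set \<Rightarrow> nat" where
  "module_rank M = (GREATEST r. \<exists>B\<subseteq>M. finite B \<and> card B = r \<and> rvec.independent B)"

text \<open>
  A binary \<open>(n,k)\<close> convolutional code; the length is \<open>n = CARD('n)\<close>.
\<close>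

definition conv_code :: "nat \<Rightarrow> (bit poly^'n) set \<Rightarrow> bool" where
  "conv_code k C \<longleftrightarrow> rvec.subspace C \<and> module_rank C = k"

text \<open>
  The injectivity condition makes this a statement about the family of rows: a matrix with a
  repeated row is not a generator matrix, even though repetitions are invisible in \<^term>\<open>rows G\<close>.
\<close>

definition generator_matrix :: "bit poly^'n^'k \<Rightarrow> (bit poly^'n) set \<Rightarrow> bool" where
  "generator_matrix G C \<longleftrightarrow>
     inj (\<lambda>i. row i G) \<and> rvec.independent (rows G) \<and> rvec.span (rows G) = C"

definition dual_code :: "(bit poly^'n) set \<Rightarrow> (bit poly^'n) set" where
  "dual_code C = {f. \<forall>c\<in>C. (\<Sum>i\<in>UNIV. f $ i * c $ i) = 0}"

definition self_dual :: "(bit poly^'n) set \<Rightarrow> bool" where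
  "self_dual C \<longleftrightarrow> C = dual_code C"

definition G_matrix :: "bit poly \<Rightarrow> bit poly \<Rightarrow> bit poly^4^2" where
  "G_matrix g h = vector [vector [1, 1, 1, 1], vector [0, g + h, g, h]]"

end

theory Submission
  imports Defs
begin

text \<open>
  A word of the code generated by \<open>G_matrix g h\<close> is
  \<open>(a, a + b (g + h), a + b g, a + b h)\<close>. If \<open>gcd g h = 1\<close>, then the pairs
  \<open>(f\<^sub>2 + f\<^sub>3, f\<^sub>2 + f\<^sub>4)\<close> with \<open>g (f\<^sub>2 + f\<^sub>3) = h (f\<^sub>2 + f\<^sub>4)\<close> are the
  multiples of \<open>(h, g)\<close>, which is why the dual contains nothing else. Conversely, in characteristic 2 a self-orthogonal word
  \<open>c\<close> satisfies \<open>(\<Sum> c\<^sub>i)\<^sup>2 = \<Sum> c\<^sub>i\<^sup>2 = 0\<close>, so the all-one word lies in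
  the dual of a self-dual code \<open>C\<close>, that is, in \<open>C\<close>. Subtracting a multiple of it leaves the words
  \<open>(0, y + z, y, z)\<close> of \<open>C\<close>. Orthogonality makes any two of the pairs \<open>(y, z)\<close> proportional, and
  a dual code contains the primitive part of each of its words.
\<close>

section \<open>Arithmetic in characteristic 2\<close>

lemma two_eq_0_bit_poly: "2 = (0 :: bit poly)"
proof -
  have "1 + 1 = (0 :: bit poly)"
    by (rule poly_eqI) (simp only: coeff_add coeff_0, simp del: one_add_one)
  then show ?thesis
    by simp
qed

lemma add_self_bit_poly: "x + x = 0" for x :: "bit poly"
  by (metis mult_2 mult_zero_left two_eq_0_bit_poly)

lemma add_left_self_bit_poly: "x + (x + y) = y" for x y :: "bit poly"
  by (simp add: add_self_bit_poly flip: add.assoc)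

lemma add_eq_iff_bit_poly: "x + y = z \<longleftrightarrow> y = x + z" for x y z :: "bit poly"
  by (metis add_left_self_bit_poly)

text \<open>Expanding and sorting with \<open>algebra_simps\<close> brings equal monomials together,
  where they cancel in pairs.\<close>

lemmas char_2_simps =
  add_self_bit_poly add_left_self_bit_poly two_eq_0_bit_poly algebra_simps

section \<open>Modules with two generators and their rank\<close>

lemma independent_pair_iff:
  fixes v w :: "'a::comm_ring_1 ^ 'n"
  assumes "v \<noteq> w"
  shows "rvec.independent {v, w} \<longleftrightarrow> (\<forall>a b. a *s v + b *s w = 0 \<longrightarrow> a = 0 \<and> b = 0)"
proof
  assume ind: "rvec.independent {v, w}"
  show "\<forall>a b. a *s v + b *s w = 0 \<longrightarrow> a = 0 \<and> b = 0"
  proof (intro allI impI)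
    fix a b assume "a *s v + b *s w = 0"
    \<comment> \<open>Independence concerns a set and a coefficient function on it, so
      \<open>a\<close> and \<open>b\<close> can be prescribed separately only because
      \<open>v\<close> and \<open>w\<close> differ.\<close>
    then have "(if x = v then a else b) = 0" if "x \<in> {v, w}" for x
      using rvec.independentD[OF ind, of "{v, w}" "\<lambda>x. if x = v then a else b" x] that assms
      by auto
    from this[of v] this[of w] show "a = 0 \<and> b = 0"
      using assms by auto
  qed
next
  assume "\<forall>a b. a *s v + b *s w = 0 \<longrightarrow> a = 0 \<and> b = 0"
  then show "rvec.independent {v, w}"
    using assms by (auto simp: rvec.dependent_finite)
qed

lemma mem_span_pair_iff:
  fixes v w x :: "'a::comm_ring_1 ^ 'n"
  shows "x \<in> rvec.span {v, w} \<longleftrightarrow> (\<exists>a b. x = a *s v + b *s w)"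
  by (auto simp: rvec.span_insert rvec.span_singleton image_iff algebra_simps)

lemma three_pairs_dependent:
  fixes a1 a2 a3 b1 b2 b3 :: "'a::idom"
  obtains p q r where "p \<noteq> 0 \<or> q \<noteq> 0 \<or> r \<noteq> 0"
    "p * a1 + q * a2 + r * a3 = 0" "p * b1 + q * b2 + r * b3 = 0"
proof (cases "a2 * b3 - a3 * b2 = 0 \<and> a3 * b1 - a1 * b3 = 0 \<and> a1 * b2 - a2 * b1 = 0")
  case False
  then show ?thesis
    \<comment> \<open>The cross product of the two coordinate triples is orthogonal to both.\<close>
    by (intro that[of "a2 * b3 - a3 * b2" "a3 * b1 - a1 * b3" "a1 * b2 - a2 * b1"])
      (auto simp: algebra_simps)
next
  case True
  \<comment> \<open>With vanishing minors the first two pairs are already dependent, or the first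
    pair is zero.\<close>
  then have minor: "a1 * b2 = a2 * b1"
    by simp
  consider "a1 \<noteq> 0 \<or> a2 \<noteq> 0" | "b1 \<noteq> 0 \<or> b2 \<noteq> 0" | "a1 = 0" "b1 = 0"
    by blast
  then show ?thesis
  proof cases
    case 1
    then show ?thesis
      using minor by (intro that[of a2 "- a1" 0]) (auto simp: algebra_simps)
  next
    case 2
    then show ?thesis
      using minor by (intro that[of b2 "- b1" 0]) (auto simp: algebra_simps)
  next
    case 3
    then show ?thesis
      by (intro that[of 1 0 0]) auto
  qed
qed

text \<open>A relation among the coefficient pairs of three elements of the span is a relation among
  the elements themselves.\<close>

lemma card_independent_le_2:
  fixes v w :: "'a::idom ^ 'n"
  assumes "B \<subseteq> rvec.span {v, w}" "rvec.independent B"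
  shows "card B \<le> 2"
proof (rule ccontr)
  assume "\<not> card B \<le> 2"
  then obtain T where "T \<subseteq> B" "card T = 3"
    by (metis obtain_subset_with_card_n not_less_eq_eq eval_nat_numeral(3))
  then obtain x y z where T: "T = {x, y, z}" "x \<noteq> y" "y \<noteq> z" "x \<noteq> z"
    unfolding card_3_iff by blast
  have "x \<in> rvec.span {v, w}" "y \<in> rvec.span {v, w}" "z \<in> rvec.span {v, w}"
    using T \<open>T \<subseteq> B\<close> assms(1) by auto
  then obtain a1 b1 a2 b2 a3 b3
    where xyz: "x = a1 *s v + b1 *s w" "y = a2 *s v + b2 *s w" "z = a3 *s v + b3 *s w"
    unfolding mem_span_pair_iff by blast
  obtain p q r where pqr: "p \<noteq> 0 \<or> q \<noteq> 0 \<or> r \<noteq> 0"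
    "p * a1 + q * a2 + r * a3 = 0" "p * b1 + q * b2 + r * b3 = 0"
    by (rule three_pairs_dependent)
  define u where "u = (\<lambda>t. if t = x then p else if t = y then q else r)"
  have "(\<Sum>t\<in>T. u t *s t) = p *s x + q *s y + r *s z"
    using T by (auto simp: u_def add.assoc)
  also have "\<dots> = (p * a1 + q * a2 + r * a3) *s v + (p * b1 + q * b2 + r * b3) *s w"
    by (simp add: xyz vec_eq_iff algebra_simps)
  also have "\<dots> = 0"
    using pqr by simp
  finally have "(\<Sum>t\<in>T. u t *s t) = 0" .
  then have "u t = 0" if "t \<in> T" for t
    using rvec.independentD[OF assms(2) _ \<open>T \<subseteq> B\<close>] that T(1) by blast
  from this[of x] this[of y] this[of z] show False
    using pqr(1) T by (simp add: u_def)
qed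

lemma module_rank_span_pair:
  fixes v w :: "'a::idom ^ 'n"
  assumes "v \<noteq> w" "rvec.independent {v, w}"
  shows "module_rank (rvec.span {v, w}) = 2"
  unfolding module_rank_def
proof (rule Greatest_equality)
  show "\<exists>B\<subseteq>rvec.span {v, w}. finite B \<and> card B = 2 \<and> rvec.independent B"
    using assms by (intro exI[of _ "{v, w}"] conjI rvec.span_superset) auto
qed (use card_independent_le_2 in blast)

section \<open>The matrix and the code it generates\<close>

lemma vector_4 [simp]:
  "(vector [a, b, c, d] :: 'a::zero ^ 4) $ 1 = a"
  "(vector [a, b, c, d] :: 'a ^ 4) $ 2 = b"
  "(vector [a, b, c, d] :: 'a ^ 4) $ 3 = c"
  "(vector [a, b, c, d] :: 'a ^ 4) $ 4 = d"
  unfolding vector_def by simp_all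

lemma row_G_matrix:
  "row 1 (G_matrix g h) = vector [1, 1, 1, 1]"
  "row 2 (G_matrix g h) = vector [0, g + h, g, h]"
  by (simp_all add: row_def G_matrix_def vec_eq_iff)

lemma rows_G_matrix: "rows (G_matrix g h) = {vector [1, 1, 1, 1], vector [0, g + h, g, h]}"
proof -
  have "rows (G_matrix g h) = {row 1 (G_matrix g h), row 2 (G_matrix g h)}"
    unfolding rows_def by auto (metis exhaust_2)
  then show ?thesis
    by (simp add: row_G_matrix)
qed

lemma vector_one_neq: "(vector [1, 1, 1, 1] :: bit poly ^ 4) \<noteq> vector [0, g + h, g, h]"
  by (simp add: vec_eq_iff forall_4)

text \<open>The second row starts with 0, so the coefficient of the all-one row is
  \<open>v $ 1\<close>.\<close>

lemma mem_span_rows_G_matrix_iff: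
  "v \<in> rvec.span (rows (G_matrix g h)) \<longleftrightarrow>
    (\<exists>b. v $ 2 = v $ 1 + b * (g + h) \<and> v $ 3 = v $ 1 + b * g \<and> v $ 4 = v $ 1 + b * h)"
  by (auto simp: rows_G_matrix mem_span_pair_iff vec_eq_iff forall_4)

lemma independent_rows_G_matrix:
  assumes "gcd g h = 1"
  shows "rvec.independent (rows (G_matrix g h))"
proof -
  have "g \<noteq> 0 \<or> h \<noteq> 0"
    using assms by auto
  then show ?thesis
    by (auto simp: rows_G_matrix independent_pair_iff[OF vector_one_neq] vec_eq_iff forall_4)
qed

lemma generator_matrix_span_rows_G_matrix:
  assumes "gcd g h = 1"
  shows "generator_matrix (G_matrix g h) (rvec.span (rows (G_matrix g h)))"
  unfolding generator_matrix_def
proof (intro conjI refl independent_rows_G_matrix assms)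
  show "inj (\<lambda>i. row i (G_matrix g h))"
    by (simp add: inj_def forall_2 row_G_matrix vector_one_neq vector_one_neq[symmetric])
qed

section \<open>Self-duality, in both directions\<close>

lemma mem_dual_code_iff:
  "f \<in> dual_code C \<longleftrightarrow>
    (\<forall>c\<in>C. f $ 1 * c $ 1 + f $ 2 * c $ 2 + f $ 3 * c $ 3 + f $ 4 * c $ 4 = 0)"
  for C :: "(bit poly ^ 4) set"
  by (simp add: dual_code_def sum_4)

lemma coprime_proportional:
  fixes a b x y :: "'a::{idom, semiring_gcd}"
  assumes "coprime a b" "a * y = b * x"
  obtains t where "x = t * a" "y = t * b"
proof (cases "a = 0")
  case True
  \<comment> \<open>Here \<open>b\<close> is a unit and \<open>x = 0\<close>, so \<open>t\<close> is
    \<open>y\<close> times the inverse of \<open>b\<close>.\<close>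
  then have "b dvd 1"
    using assms(1) by simp
  then obtain c where "1 = b * c" ..
  then show ?thesis
    using that[of "y * c"] True assms(2) by (auto simp: algebra_simps)
next
  case False
  have "a dvd b * x"
    using assms(2) by (metis dvd_triv_left)
  then have "a dvd x"
    using assms(1) by (simp add: coprime_dvd_mult_right_iff)
  then obtain t where t: "x = a * t" ..
  then have "y = t * b"
    using assms(2) False by (simp add: algebra_simps)
  then show ?thesis
    using that[of t] t by (simp add: mult.commute)
qed

lemma self_dual_span_rows_G_matrix:
  assumes "gcd g h = 1"
  shows "self_dual (rvec.span (rows (G_matrix g h)))" (is "self_dual ?C")
proof -
  have "f \<in> dual_code ?C" if "f \<in> ?C" for f
    unfolding mem_dual_code_iff
  proof
    fix c assume "c \<in> ?C"
    \<comment> \<open>After expansion every monomial occurs an even number of times.\<close>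
    with \<open>f \<in> ?C\<close> show "f $ 1 * c $ 1 + f $ 2 * c $ 2 + f $ 3 * c $ 3 + f $ 4 * c $ 4 = 0"
      unfolding mem_span_rows_G_matrix_iff by (auto simp: char_2_simps)
  qed
  moreover have "f \<in> ?C" if f: "f \<in> dual_code ?C" for f
  proof -
    have "vector [1, 1, 1, 1] \<in> ?C" "vector [0, g + h, g, h] \<in> ?C"
      by (auto simp: rows_G_matrix intro!: rvec.span_base)
    with f have f0: "f $ 1 + f $ 2 + f $ 3 + f $ 4 = 0"
      and f1: "f $ 2 * (g + h) + f $ 3 * g + f $ 4 * h = 0"
      unfolding mem_dual_code_iff by fastforce+
    have "h * (f $ 2 + f $ 4) = g * (f $ 2 + f $ 3)"
      using f1 by (simp add: char_2_simps add_eq_iff_bit_poly)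
    moreover have "coprime h g"
      using assms by (simp add: coprime_iff_gcd_eq_1 gcd.commute)
    ultimately obtain t where "f $ 2 + f $ 3 = t * h" "f $ 2 + f $ 4 = t * g"
      by (metis coprime_proportional)
    \<comment> \<open>By \<open>f0\<close>, \<open>f $ 1 + f $ 3 = f $ 2 + f $ 4\<close> and
      \<open>f $ 1 + f $ 4 = f $ 2 + f $ 3\<close>, which swaps the roles of \<open>g\<close> and
      \<open>h\<close>.\<close>
    then have "f $ 2 = f $ 1 + t * (g + h)" "f $ 3 = f $ 1 + t * g" "f $ 4 = f $ 1 + t * h"
      using f0 by (simp_all add: char_2_simps add_eq_iff_bit_poly)
    then show ?thesis
      unfolding mem_span_rows_G_matrix_iff by blast
  qed
  ultimately show ?thesis
    unfolding self_dual_def by blast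
qed

lemma self_dual_generator_matrix:
  fixes C :: "(bit poly ^ 4) set"
  assumes "rvec.subspace C" "self_dual C"
  obtains g h where "gcd g h = 1" "generator_matrix (G_matrix g h) C"
proof -
  define dot :: "bit poly ^ 4 \<Rightarrow> bit poly ^ 4 \<Rightarrow> bit poly"
    where "dot f c = f $ 1 * c $ 1 + f $ 2 * c $ 2 + f $ 3 * c $ 3 + f $ 4 * c $ 4" for f c
  have mem_C: "f \<in> C \<longleftrightarrow> (\<forall>c\<in>C. dot f c = 0)" for f
    using assms(2) unfolding self_dual_def dot_def by (metis mem_dual_code_iff)
  have sum_C: "c $ 1 + c $ 2 + c $ 3 + c $ 4 = 0" if "c \<in> C" for c
  proof -
    have "dot c c = 0"
      using mem_C that by blast
    then have "(c $ 1 + c $ 2 + c $ 3 + c $ 4) ^ 2 = 0"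
      by (simp add: dot_def power2_eq_square char_2_simps)
    then show ?thesis
      by simp
  qed
  define one :: "bit poly ^ 4" where "one = vector [1, 1, 1, 1]"
  have one_C: "one \<in> C"
    unfolding mem_C by (simp add: one_def dot_def sum_C)
  \<comment> \<open>Otherwise \<open>(1, 0, 1, 0)\<close> would be orthogonal to \<open>C\<close>
    and hence in \<open>C\<close>, although its first and fourth entries differ.\<close>
  have "\<exists>c\<in>C. c $ 1 \<noteq> c $ 3 \<or> c $ 1 \<noteq> c $ 4"
  proof (rule ccontr)
    assume neg: "\<not> (\<exists>c\<in>C. c $ 1 \<noteq> c $ 3 \<or> c $ 1 \<noteq> c $ 4)"
    then have "dot (vector [1, 0, 1, 0]) c = 0" if "c \<in> C" for c
      using that by (auto simp: dot_def add_self_bit_poly two_eq_0_bit_poly)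
    then have "vector [1, 0, 1, 0] \<in> C"
      using mem_C by blast
    then show False
      using neg by fastforce
  qed
  then obtain c where c: "c \<in> C" "c $ 1 \<noteq> c $ 3 \<or> c $ 1 \<noteq> c $ 4"
    by blast
  \<comment> \<open>Adding \<open>c $ 1\<close> times \<open>one\<close> to \<open>c\<close> gives
    \<open>(0, y + z, y, z)\<close>, the second entry by \<open>sum_C\<close>.\<close>
  define y z where "y = c $ 1 + c $ 3" and "z = c $ 1 + c $ 4"
  have "gcd y z \<noteq> 0"
    using c(2) by (auto simp: y_def z_def add_eq_iff_bit_poly)
  then obtain e g h where "e \<noteq> 0" and gh: "y = g * e" "z = h * e" "coprime g h"
    using gcd_coprime_exists by blast
  \<comment> \<open>Orthogonality is shown for the multiple by \<open>e\<close>, which lies in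
    \<open>C\<close>, and the nonzero factor \<open>e\<close> is then cancelled.\<close>
  have orth: "dot (vector [0, g + h, g, h]) d = 0" if "d \<in> C" for d
  proof -
    have "e * dot (vector [0, g + h, g, h]) d = dot (vector [0, y + z, y, z]) d"
      by (simp add: dot_def gh(1,2) algebra_simps)
    also have "\<dots> = dot c d + c $ 1 * dot one d"
      using sum_C[OF c(1)]
      by (simp add: dot_def one_def y_def z_def char_2_simps add_eq_iff_bit_poly)
    also have "\<dots> = 0"
    proof -
      have "dot c d = 0" "dot one d = 0"
        using that c(1) one_C mem_C by blast+
      then show ?thesis
        by simp
    qed
    finally show ?thesis
      using \<open>e \<noteq> 0\<close> by simp
  qed
  have "rvec.span (rows (G_matrix g h)) = C"
  proof
    have "vector [0, g + h, g, h] \<in> C"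
      using orth mem_C by blast
    then show "rvec.span (rows (G_matrix g h)) \<subseteq> C"
      using one_C assms(1) by (intro rvec.span_minimal) (auto simp: rows_G_matrix one_def)
    show "C \<subseteq> rvec.span (rows (G_matrix g h))"
    proof
      fix d assume d: "d \<in> C"
      \<comment> \<open>By \<open>sum_C\<close>, \<open>d $ 2 + d $ 3 = d $ 1 + d $ 4\<close> and
        \<open>d $ 2 + d $ 4 = d $ 1 + d $ 3\<close>, so \<open>orth\<close> becomes a
        proportionality with \<open>(g, h)\<close>.\<close>
      have "g * (d $ 1 + d $ 4) = h * (d $ 1 + d $ 3)"
        using orth[OF d] sum_C[OF d] by (simp add: dot_def char_2_simps add_eq_iff_bit_poly)
      then obtain t where "d $ 1 + d $ 3 = t * g" "d $ 1 + d $ 4 = t * h"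
        by (metis coprime_proportional gh(3))
      then have "d $ 2 = d $ 1 + t * (g + h)" "d $ 3 = d $ 1 + t * g" "d $ 4 = d $ 1 + t * h"
        using sum_C[OF d] by (simp_all add: char_2_simps add_eq_iff_bit_poly)
      then show "d \<in> rvec.span (rows (G_matrix g h))"
        unfolding mem_span_rows_G_matrix_iff by blast
    qed
  qed
  moreover have "gcd g h = 1"
    using gh(3) by (simp add: coprime_iff_gcd_eq_1)
  ultimately show ?thesis
    using that[of g h] generator_matrix_span_rows_G_matrix[of g h] by simp
qed

theorem mainTheorem3:
  shows "(\<forall>g h :: bit poly. gcd g h = 1 \<longrightarrow>
            (\<exists>C :: (bit poly^4) set.
               conv_code 2 C \<and> self_dual C \<and> generator_matrix (G_matrix g h) C)) \<and>
         (\<forall>C :: (bit poly^4) set. conv_code 2 C \<and> self_dual C \<longrightarrow>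
            (\<exists>g h :: bit poly. gcd g h = 1 \<and> generator_matrix (G_matrix g h) C))"
proof (intro conjI allI impI)
  fix g h :: "bit poly" assume gh: "gcd g h = 1"
  let ?C = "rvec.span (rows (G_matrix g h))"
  have "module_rank ?C = 2"
    using independent_rows_G_matrix[OF gh] unfolding rows_G_matrix
    by (rule module_rank_span_pair[OF vector_one_neq])
  then show "\<exists>C. conv_code 2 C \<and> self_dual C \<and> generator_matrix (G_matrix g h) C"
    using self_dual_span_rows_G_matrix[OF gh] generator_matrix_span_rows_G_matrix[OF gh]
    unfolding conv_code_def by blast
next
  fix C :: "(bit poly^4) set" assume "conv_code 2 C \<and> self_dual C"
  then show "\<exists>g h. gcd g h = 1 \<and> generator_matrix (G_matrix g h) C"
    unfolding conv_code_def by (metis self_dual_generator_matrix)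
qed

end
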